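(* For every integer $k\ge 2$ there exists a preference profile $\mathcal{P}^*_k$ with $n=2k$ voters and $m=4k$ alternatives such that the following holds. (a) The profile $\mathcal{P}^*_k$ is not one-dimensional Euclidean. (b) The profile $\mathcal{P}^*_k$ is minimal in the following sense: the deletion of an arbitrary voter from $\mathcal{P}^*_k$ yields a one-dimensional Euclidean profile.
   Context: A preference profile with $n$ voters $v_1,\dots,v_n$ and $m$ alternatives $1,\dots,m$ assigns to each voter $v_i$ a strict linear order $\succ_i$ on the set of alternatives ($a\succ_i b$ means that $v_i$ strictly prefers $a$ to $b$). Deleting a voter means removing this voter together with his order, keeping all alternatives and all other voters. A preference profile is one-dimensional Euclidean if one can assign to every alternative $j$ a real number $E[j]$ and to every voter $v_i$ a real number $F[i]$ such that for every voter $v_i$ and every pair $a,b$ of alternatives, $a\succ_i b$ holds if and only if $|F[i]-E[a]|<|F[i]-E[b]|$. *)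

theory Defs
  imports Complex_Main
begin

(* (a, b) \<in> P v reads "voter v strictly prefers a to b".  The inclusion in A \<times> A is required
   separately because strict_linear_order_on does not confine the relation to A. *)
definition preference_profile :: "'v set \<Rightarrow> 'a set \<Rightarrow> ('v \<Rightarrow> 'a rel) \<Rightarrow> bool" where
  "preference_profile V A P \<longleftrightarrow>
     finite V \<and> finite A \<and> (\<forall>v\<in>V. P v \<subseteq> A \<times> A \<and> strict_linear_order_on A (P v))"

(* F places the voters and E the alternatives on the real line. *)
definition one_dim_Euclidean :: "'v set \<Rightarrow> 'a set \<Rightarrow> ('v \<Rightarrow> 'a rel) \<Rightarrow> bool" where
  "one_dim_Euclidean V A P \<longleftrightarrow>
     (\<exists>(E :: 'a \<Rightarrow> real) (F :: 'v \<Rightarrow> real).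
        \<forall>v\<in>V. \<forall>a\<in>A. \<forall>b\<in>A. (a, b) \<in> P v \<longleftrightarrow> \<bar>F v - E a\<bar> < \<bar>F v - E b\<bar>)"

end

theory Submission
  imports Defs
begin

text \<open>
  Group the alternatives into \<open>2k\<close> short intervals \<open>{2j - 1, 2j}\<close> with centre \<open>4^j\<close> and radius
  \<open>\<rho> j\<close>, and put voter \<open>v < 2k\<close> halfway between the centres \<open>v\<close> and \<open>v + 1\<close>, and voter \<open>2k\<close>
  halfway between the centres \<open>1\<close> and \<open>2k\<close>. All sums of two centres are distinct, so the order of
  voter \<open>v\<close> depends on the radii only through the comparison of the two intervals he is halfway
  between. Voter \<open>v\<close> is taken to declare interval \<open>v\<close> shorter than its cyclic successor. These
  \<open>2k\<close> declarations are cyclic, hence contradictory, but any \<open>2k - 1\<close> of them are satisfied by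
  suitable radii.
\<close>

definition lo :: "nat \<Rightarrow> nat \<Rightarrow> nat" where
  "lo k v = (if v < 2 * k then v else 1)"

definition hi :: "nat \<Rightarrow> nat \<Rightarrow> nat" where
  "hi k v = (if v < 2 * k then Suc v else 2 * k)"

definition blk :: "nat \<Rightarrow> nat" where
  "blk a = (a + 1) div 2"

text \<open>
  For \<open>a < b\<close>: voter \<open>v\<close> lies to the left of the midpoint of \<open>a\<close> and \<open>b\<close>. When the centres tie,
  the longer of the two intervals decides, namely the right one for \<open>v < 2k\<close> and the left one for
  \<open>v = 2k\<close>.
\<close>

definition left_of_mid :: "nat \<Rightarrow> nat \<Rightarrow> nat \<Rightarrow> nat \<Rightarrow> bool" where
  "left_of_mid k v a b \<longleftrightarrow>
     (4::nat) ^ lo k v + 4 ^ hi k v < 4 ^ blk a + 4 ^ blk b \<or>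
     (4::nat) ^ lo k v + 4 ^ hi k v = 4 ^ blk a + 4 ^ blk b \<and> even (if v < 2 * k then b else a)"

text \<open>Only integers are compared here, because no single family of radii realises all voters
  at once.\<close>

definition cyclic_profile :: "nat \<Rightarrow> nat \<Rightarrow> nat rel" where
  "cyclic_profile k v =
     {(a, b). a \<in> {1..4 * k} \<and> b \<in> {1..4 * k} \<and>
        (a < b \<and> left_of_mid k v a b \<or> b < a \<and> \<not> left_of_mid k v b a)}"

text \<open>On \<open>{1..2 * k}\<close> these radii increase in the cyclic order that starts just
  after \<open>w\<close> and ends at \<open>w\<close>, which respects every declaration except that
  of voter \<open>w\<close>. The denominator keeps them below 1/2.\<close>

definition radius :: "nat \<Rightarrow> nat \<Rightarrow> nat \<Rightarrow> real" where
  "radius k w j = real (if j \<le> w then j + 2 * k else j) / real (8 * k + 1)"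

definition alt_pos :: "(nat \<Rightarrow> real) \<Rightarrow> nat \<Rightarrow> real" where
  "alt_pos \<rho> a = 4 ^ blk a + (if even a then \<rho> (blk a) else - \<rho> (blk a))"

definition voter_pos :: "nat \<Rightarrow> nat \<Rightarrow> real" where
  "voter_pos k v = (4 ^ lo k v + 4 ^ hi k v) / 2"

lemma four_power_sum_less:
  fixes s t p q :: nat
  assumes "s \<le> t" "t < q"
  shows "(4::nat) ^ s + 4 ^ t < 4 ^ p + 4 ^ q"
proof -
  have "(4::nat) ^ s \<le> 4 ^ t" using assms by simp
  moreover have "(4::nat) ^ Suc t \<le> 4 ^ q" using assms by (intro power_increasing) auto
  moreover have "(4::nat) ^ t > 0" "(4::nat) ^ p > 0" by simp_all
  ultimately show ?thesis unfolding power_Suc by linarith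
qed

lemma four_power_sum_inject:
  fixes s t p q :: nat
  assumes "s \<le> t" "p \<le> q" and eq: "(4::nat) ^ s + 4 ^ t = 4 ^ p + 4 ^ q"
  shows "s = p \<and> t = q"
proof -
  have "t = q"
    using four_power_sum_less[of s t q p] four_power_sum_less[of p q t s] assms
    by (metis nat_neq_iff)
  with eq show ?thesis by simp
qed

lemma abs_diff_less_iff:
  fixes f x y :: real
  assumes "x < y"
  shows "\<bar>f - x\<bar> < \<bar>f - y\<bar> \<longleftrightarrow> 2 * f < x + y" "\<bar>f - y\<bar> < \<bar>f - x\<bar> \<longleftrightarrow> x + y < 2 * f"
  using assms by linarith+

lemma lo_less_hi: "k \<ge> 2 \<Longrightarrow> lo k v < hi k v"
  by (simp add: lo_def hi_def)

lemma blk_bounds: "a \<in> {1..4 * k} \<Longrightarrow> blk a \<in> {1..2 * k}"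
  by (auto simp: blk_def)

lemma blk_mono: "a \<le> b \<Longrightarrow> blk a \<le> blk b"
  by (simp add: blk_def div_le_mono)

section \<open>Realising all voters but one\<close>

lemma radius_bounds:
  assumes "j \<in> {1..2 * k}"
  shows "0 < radius k w j" "radius k w j < 1 / 2"
  using assms by (auto simp: radius_def field_simps)

lemma radius_lo_hi:
  assumes "k \<ge> 2" "v \<in> {1..2 * k}" "w \<in> {1..2 * k}" "v \<noteq> w"
  shows "if v < 2 * k then radius k w (lo k v) < radius k w (hi k v)
         else radius k w (hi k v) < radius k w (lo k v)"
  using assms by (auto simp: radius_def lo_def hi_def divide_strict_right_mono)

lemma alt_pos_strict_mono:
  assumes "a < b" "a \<in> {1..4 * k}" "b \<in> {1..4 * k}"
  shows "alt_pos (radius k w) a < alt_pos (radius k w) b"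
proof -
  note ra = radius_bounds[OF blk_bounds[OF assms(2)], of w]
  note rb = radius_bounds[OF blk_bounds[OF assms(3)], of w]
  show ?thesis
  proof (cases "blk a = blk b")
    case True
    then have "odd a" "even b" using \<open>a < b\<close> unfolding blk_def by presburger+
    with True ra show ?thesis by (simp add: alt_pos_def)
  next
    case False
    then have "blk a < blk b" using blk_mono[of a b] assms by simp
    then have "(4::nat) ^ blk a + 1 \<le> 4 ^ blk b" by (simp add: Suc_le_eq)
    then have "(4::real) ^ blk a + 1 \<le> 4 ^ blk b"
      by (simp flip: of_nat_le_iff[where 'a = real])
    with ra rb show ?thesis by (auto simp: alt_pos_def)
  qed
qed

text \<open>Twice the voter's position and the sum of the two centres are integers. If they differ,
  two radii below 1/2 cannot close the gap; if they agree, both intervals are the voter's own and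
  the larger radius fixes the sign.\<close>

lemma voter_pos_vs_midpoint:
  assumes k: "k \<ge> 2" and v: "v \<in> {1..2 * k}" and w: "w \<in> {1..2 * k}" and vw: "v \<noteq> w"
    and ab: "a < b" and a: "a \<in> {1..4 * k}" and b: "b \<in> {1..4 * k}"
  defines "S \<equiv> alt_pos (radius k w) a + alt_pos (radius k w) b"
  shows "if left_of_mid k v a b then 2 * voter_pos k v < S else S < 2 * voter_pos k v"
proof -
  note ra = radius_bounds[OF blk_bounds[OF a], of w]
  note rb = radius_bounds[OF blk_bounds[OF b], of w]
  define m n where "m = (4::nat) ^ lo k v + 4 ^ hi k v" and "n = (4::nat) ^ blk a + 4 ^ blk b"
  have F: "2 * voter_pos k v = real m" by (simp add: voter_pos_def m_def)
  have S: "S = real n + (if even a then radius k w (blk a) else - radius k w (blk a))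
                      + (if even b then radius k w (blk b) else - radius k w (blk b))"
    by (simp add: S_def alt_pos_def n_def)
  have L: "left_of_mid k v a b \<longleftrightarrow> m < n \<or> m = n \<and> even (if v < 2 * k then b else a)"
    by (simp add: left_of_mid_def m_def n_def)
  consider "m < n" | "n < m" | "m = n" by linarith
  then show ?thesis
  proof cases
    case 1
    then have "real m + 1 \<le> real n" by linarith
    with 1 ra rb show ?thesis unfolding F S L by auto
  next
    case 2
    then have "real n + 1 \<le> real m" by linarith
    with 2 ra rb show ?thesis unfolding F S L by auto
  next
    case 3
    then have "lo k v = blk a" "hi k v = blk b"
      using four_power_sum_inject[of "lo k v" "hi k v" "blk a" "blk b"]
        lo_less_hi[OF k, of v] blk_mono[of a b] ab
      by (auto simp: m_def n_def)
    with radius_lo_hi[OF k v w vw] 3 ra rb show ?thesis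
      unfolding F S L by (auto split: if_splits)
  qed
qed

lemma cyclic_profile_iff:
  assumes "k \<ge> 2" "v \<in> {1..2 * k}" "w \<in> {1..2 * k}" "v \<noteq> w"
    and a: "a \<in> {1..4 * k}" and b: "b \<in> {1..4 * k}"
  shows "(a, b) \<in> cyclic_profile k v \<longleftrightarrow>
    \<bar>voter_pos k v - alt_pos (radius k w) a\<bar> < \<bar>voter_pos k v - alt_pos (radius k w) b\<bar>"
proof (cases a b rule: linorder_cases)
  case less
  show ?thesis
    using voter_pos_vs_midpoint[OF assms(1-4) less a b] less a b
      abs_diff_less_iff(1)[OF alt_pos_strict_mono[OF less a b, of w], of "voter_pos k v"]
    by (auto simp: cyclic_profile_def split: if_splits)
next
  case equal
  then show ?thesis by (simp add: cyclic_profile_def)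
next
  case greater
  show ?thesis
    using voter_pos_vs_midpoint[OF assms(1-4) greater b a] greater a b
      abs_diff_less_iff(2)[OF alt_pos_strict_mono[OF greater b a, of w], of "voter_pos k v"]
    by (auto simp: cyclic_profile_def add.commute split: if_splits)
qed

lemma cyclic_profile_total:
  "\<lbrakk>a \<in> {1..4 * k}; b \<in> {1..4 * k}; a \<noteq> b\<rbrakk>
    \<Longrightarrow> (a, b) \<in> cyclic_profile k v \<or> (b, a) \<in> cyclic_profile k v"
  by (auto simp: cyclic_profile_def)

lemma preference_profile_cyclic:
  assumes k: "k \<ge> 2"
  shows "preference_profile {1..2 * k} {1..4 * k} (cyclic_profile k)"
  unfolding preference_profile_def
proof (intro conjI ballI)
  fix v assume v: "v \<in> {1..2 * k}"
  show sub: "cyclic_profile k v \<subseteq> {1..4 * k} \<times> {1..4 * k}"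
    by (auto simp: cyclic_profile_def)
  \<comment> \<open>Deleting some other voter \<open>w\<close> yields positions that represent the
    order of \<open>v\<close>, so transitivity is inherited from \<open><\<close> on
    distances.\<close>
  obtain w where w: "w \<in> {1..2 * k}" "v \<noteq> w"
    using k by (cases "v = 1") (auto intro: that[of 1] that[of 2])
  note iff = cyclic_profile_iff[OF k v w]
  have "trans (cyclic_profile k v)"
  proof (rule transI)
    fix x y z assume xy: "(x, y) \<in> cyclic_profile k v" and yz: "(y, z) \<in> cyclic_profile k v"
    then have "x \<in> {1..4 * k}" "y \<in> {1..4 * k}" "z \<in> {1..4 * k}" using sub by blast+
    with xy yz show "(x, z) \<in> cyclic_profile k v" by (simp only: iff)
  qed
  then show "strict_linear_order_on {1..4 * k} (cyclic_profile k v)"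
    unfolding strict_linear_order_on_def
    using cyclic_profile_total by (auto simp: irrefl_def total_on_def cyclic_profile_def)
qed auto

lemma one_dim_Euclidean_cyclic_delete:
  assumes "k \<ge> 2" "w \<in> {1..2 * k}"
  shows "one_dim_Euclidean ({1..2 * k} - {w}) {1..4 * k} (cyclic_profile k)"
  unfolding one_dim_Euclidean_def
  using cyclic_profile_iff assms
  by (intro exI[of _ "alt_pos (radius k w)"] exI[of _ "voter_pos k"]) auto

section \<open>Contradiction from a representation of all voters\<close>

lemma cyclic_profile_Euclidean_False:
  fixes E F :: "nat \<Rightarrow> real"
  assumes k: "k \<ge> 2"
    and EF: "\<And>v a b. \<lbrakk>v \<in> {1..2 * k}; (a, b) \<in> cyclic_profile k v\<rbrakk>
               \<Longrightarrow> \<bar>F v - E a\<bar> < \<bar>F v - E b\<bar>"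
    and orient: "E 1 < E (4 * k)"
  shows False
proof -
  let ?A = "{1..4 * k}"
  have left: "\<bar>F v - E a\<bar> < \<bar>F v - E b\<bar>"
    if "left_of_mid k v a b" "v \<in> {1..2 * k}" "a \<in> ?A" "b \<in> ?A" "a < b" for v a b
    using that by (intro EF) (auto simp: cyclic_profile_def)
  have right: "\<bar>F v - E b\<bar> < \<bar>F v - E a\<bar>"
    if "\<not> left_of_mid k v a b" "v \<in> {1..2 * k}" "a \<in> ?A" "b \<in> ?A" "a < b" for v a b
    using that by (intro EF) (auto simp: cyclic_profile_def)

  text \<open>A last choice is always an endpoint of the axis, here the left one by orientation.\<close>
  have last_1: "\<bar>F (2 * k) - E b\<bar> < \<bar>F (2 * k) - E 1\<bar>" if "b \<in> ?A" "1 < b" for b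
  proof (rule right)
    have "blk b \<le> 2 * k" using blk_bounds[of b k] that by simp
    then have "(4::nat) ^ blk b \<le> 4 ^ (2 * k)" by (intro power_increasing) auto
    then show "\<not> left_of_mid k (2 * k) 1 b"
      by (simp add: left_of_mid_def lo_def hi_def blk_def)
  qed (use that k in auto)
  have E1: "E 1 < E b" if "b \<in> ?A" "1 < b" for b
    using last_1[of b] last_1[of "4 * k"] that orient k by auto

  \<comment> \<open>Preferring 1 to \<open>b\<close> puts voter 1 to the left of the midpoint of the
    two, so whatever he prefers to \<open>b\<close> lies left of \<open>b\<close>.\<close>
  have voter_1: "\<bar>F 1 - E a\<bar> < \<bar>F 1 - E b\<bar>" if "a \<in> ?A" "b \<in> ?A" "a < b" "4 \<le> b" for a b
  proof (rule left)
    show "left_of_mid k 1 a b"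
    proof (cases "b = 4")
      case True
      with that consider "a = 1" | "a = 2" | "a = 3" by fastforce
      then show ?thesis
        using True k by cases (auto simp: left_of_mid_def lo_def hi_def blk_def)
    next
      case False
      then have "2 < blk b" using that by (simp add: blk_def)
      then show ?thesis
        using four_power_sum_less[of 1 2 "blk b" "blk a"] k
        by (simp add: left_of_mid_def lo_def hi_def)
    qed
  qed (use that k in auto)

  have mono: "E a < E b" if "a \<in> ?A" "b \<in> ?A" "a < b" for a b
  proof -
    from that consider "a = 1" | "4 \<le> b" | "a = 2" "b = 3" by fastforce
    then show ?thesis
    proof cases
      case 1
      then show ?thesis using E1 that by simp
    next
      case 2
      then show ?thesis using voter_1[of 1 b] voter_1[of a b] E1[of b] that by auto
    next
      \<comment> \<open>Voter 1 prefers 3 to 2, so voter 2 must settle this pair: he is right of the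
        midpoint of 2 and 6 but left of that of 3 and 6.\<close>
      case 3
      have "\<bar>F 2 - E 3\<bar> < \<bar>F 2 - E 6\<bar>" "\<bar>F 2 - E 6\<bar> < \<bar>F 2 - E 2\<bar>"
        using left[of 2 3 6] right[of 2 2 6] k
        by (auto simp: left_of_mid_def lo_def hi_def blk_def)
      moreover have "E 2 < E 6" "E 3 < E 6"
        using voter_1[of 1 6] voter_1[of 2 6] voter_1[of 3 6] E1[of 6] k by auto
      ultimately show ?thesis unfolding 3 by linarith
    qed
  qed

  define len where "len i = E (2 * i) - E (2 * i - 1)" for i
  \<comment> \<open>Voter \<open>i\<close> is right of the midpoint of the inner endpoints and left
    of that of the outer ones; comparing the two sums of endpoints compares the lengths.\<close>
  have len_less: "len i < len (Suc i)" if "1 \<le> i" "i < 2 * k" for i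
  proof -
    have "blk (2 * i) = i" "blk (2 * i - 1) = i" "blk (2 * i + 1) = Suc i" "blk (2 * i + 2) = Suc i"
      using that by (auto simp: blk_def)
    then have "\<not> left_of_mid k i (2 * i) (2 * i + 1)" "left_of_mid k i (2 * i - 1) (2 * i + 2)"
      using that by (auto simp: left_of_mid_def lo_def hi_def)
    then have "\<bar>F i - E (2 * i + 1)\<bar> < \<bar>F i - E (2 * i)\<bar>"
      "\<bar>F i - E (2 * i - 1)\<bar> < \<bar>F i - E (2 * i + 2)\<bar>"
      using left[of i "2 * i - 1" "2 * i + 2"] right[of i "2 * i" "2 * i + 1"] that by auto
    moreover have "E (2 * i) < E (2 * i + 1)" "E (2 * i - 1) < E (2 * i + 2)"
      using that by (auto intro!: mono)
    ultimately show ?thesis by (simp add: len_def)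
  qed
  have "len 1 \<le> len i" if "1 \<le> i" "i \<le> 2 * k" for i
    using that
  proof (induction i rule: dec_induct)
    case (step i)
    then show ?case using len_less[of i] by simp
  qed simp
  from this[of "2 * k"] have "len 1 \<le> len (2 * k)" using k by simp
  \<comment> \<open>Voter \<open>2 * k\<close> closes the cycle: for intervals 1 and
    \<open>2 * k\<close> he has the opposite position relative to both midpoints.\<close>
  moreover have "len (2 * k) < len 1"
  proof -
    have "blk (4 * k) = 2 * k" "blk (4 * k - 1) = 2 * k" "blk 1 = 1" "blk 2 = 1"
      using k by (auto simp: blk_def)
    then have "left_of_mid k (2 * k) 2 (4 * k - 1)" "\<not> left_of_mid k (2 * k) 1 (4 * k)"
      by (auto simp: left_of_mid_def lo_def hi_def)
    then have "\<bar>F (2 * k) - E 2\<bar> < \<bar>F (2 * k) - E (4 * k - 1)\<bar>"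
      "\<bar>F (2 * k) - E (4 * k)\<bar> < \<bar>F (2 * k) - E 1\<bar>"
      using left[of "2 * k" 2 "4 * k - 1"] right[of "2 * k" 1 "4 * k"] k by auto
    moreover have "E 2 < E (4 * k - 1)" using k by (auto intro!: mono)
    ultimately show ?thesis using orient by (simp add: len_def)
  qed
  ultimately show False by simp
qed

lemma not_one_dim_Euclidean_cyclic:
  assumes k: "k \<ge> 2"
  shows "\<not> one_dim_Euclidean {1..2 * k} {1..4 * k} (cyclic_profile k)"
proof
  assume "one_dim_Euclidean {1..2 * k} {1..4 * k} (cyclic_profile k)"
  then obtain E F :: "nat \<Rightarrow> real"
    where EF: "\<And>v a b. \<lbrakk>v \<in> {1..2 * k}; (a, b) \<in> cyclic_profile k v\<rbrakk>
      \<Longrightarrow> \<bar>F v - E a\<bar> < \<bar>F v - E b\<bar>"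
    unfolding one_dim_Euclidean_def cyclic_profile_def by fast
  have "E 1 \<noteq> E (4 * k)"
    using cyclic_profile_total[of 1 k "4 * k" 1] EF[of 1 1 "4 * k"] EF[of 1 "4 * k" 1] k by auto
  then consider "E 1 < E (4 * k)" | "- E 1 < - E (4 * k)" by linarith
  then show False
  proof cases
    case 1
    then show ?thesis using cyclic_profile_Euclidean_False[of k F E] k EF by blast
  next
    case 2
    \<comment> \<open>Reflecting the line preserves distances and restores the required
      orientation.\<close>
    have "\<bar>- F v - - E a\<bar> < \<bar>- F v - - E b\<bar>"
      if "v \<in> {1..2 * k}" "(a, b) \<in> cyclic_profile k v" for v a b
      using EF[OF that] by linarith
    then show ?thesis
      using cyclic_profile_Euclidean_False[of k "\<lambda>v. - F v" "\<lambda>a. - E a"] k 2 by blast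
  qed
qed

theorem theorem3p1:
  fixes k :: nat
  assumes "k \<ge> 2"
  shows "\<exists>P :: nat \<Rightarrow> nat rel.
           preference_profile {1..2 * k} {1..4 * k} P \<and>
           \<not> one_dim_Euclidean {1..2 * k} {1..4 * k} P \<and>
           (\<forall>v\<in>{1..2 * k}. one_dim_Euclidean ({1..2 * k} - {v}) {1..4 * k} P)"
  using preference_profile_cyclic[OF assms] not_one_dim_Euclidean_cyclic[OF assms]
    one_dim_Euclidean_cyclic_delete[OF assms]
  by blast

end
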